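(* Let $c\in\mathbb{R}$, let $z:(0,\infty)\to\mathbb{R}$ be smooth, and let $M_c^2$ be the helicoidal surface $\mathbf{R}(u,t)=(u\cos t,\,u\sin t,\,z(u)+ct)$, $u>0$, $t\in\mathbb{R}$, in simply isotropic space, with parabolic Gauss map $\mathbf{G}=(G^1,G^2,G^3)$. Suppose that the top-view projection of $\mathbf{G}$ is of coordinate finite-type with equal eigenvalues, i.e. there is $\lambda\in\mathbb{R}$ ($\lambda=\lambda_1=\lambda_2$) with $-\Delta G^1=\lambda G^1$ and $-\Delta G^2=\lambda G^2$. If, in addition, the third coordinate of $\mathbf{G}$ is an eigenfunction of the Laplacian, $-\Delta G^3=\lambda_3G^3$ for some $\lambda_3\in\mathbb{R}$, then $M_c^2$ is a piece of a plane.
   Context: Simply isotropic space $\mathbb{I}^3$ is $\mathbb{R}^3$ with the degenerate inner product $\langle X,Y\rangle=x_1y_1+x_2y_2$. For an admissible surface $\mathbf{x}(u^1,u^2)$ (one whose induced metric $g_{ij}=\langle\partial_i\mathbf{x},\partial_j\mathbf{x}\rangle$ has rank 2), write $\mathbf{N}_m=(\mathbf{x}_1\times\mathbf{x}_2)/X_{12}=(N^1,N^2,1)$, where $\times$ is the Euclidean cross product and $X_{12}$ is the third coordinate of $\mathbf{x}_1\times\mathbf{x}_2$. The parabolic normal (isotropic, or parabolic, Gauss map) is $$\mathbf{G}=\Big(N^1,\,N^2,\,\tfrac12-\tfrac12\big[(N^1)^2+(N^2)^2\big]\Big).$$ $\Delta$ is the Laplace-Beltrami operator of $g_{ij}$.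 The top-view projection of $\mathbf{G}$ is the pair $(G^1,G^2)$. For the helicoidal surface $\mathbf{R}$, $$\mathbf{G}=\Big(\tfrac{c}{u}\sin t-z'\cos t,\;-\tfrac{c}{u}\cos t-z'\sin t,\;\tfrac12\big(1-\tfrac{c^2}{u^2}-z'^2\big)\Big),\qquad \Delta=\frac{\partial^2}{\partial u^2}+\frac1u\frac{\partial}{\partial u}+\frac1{u^2}\frac{\partial^2}{\partial t^2}.$$ *)

theory Defs
  imports "HOL-Analysis.Analysis"
begin

text \<open>
  Parametrized surfaces in simply isotropic space are maps from \<open>real^2\<close> to \<open>real^3\<close>,
  considered on an open parameter domain. All differential operators below are local, so the
  values of a map outside its domain do not matter.
\<close>

definition partial :: "2 \<Rightarrow> (real^2 \<Rightarrow> 'a::real_normed_vector) \<Rightarrow> real^2 \<Rightarrow> 'a" where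
  "partial i f p = vector_derivative (\<lambda>s. f (p + s *\<^sub>R axis i 1)) (at 0)"

definition iso_inner :: "real^3 \<Rightarrow> real^3 \<Rightarrow> real" where
  "iso_inner X Y = X$1 * Y$1 + X$2 * Y$2"

definition iso_metric :: "(real^2 \<Rightarrow> real^3) \<Rightarrow> real^2 \<Rightarrow> real^2^2" where
  "iso_metric x p = (\<chi> i j. iso_inner (partial i x p) (partial j x p))"

definition laplace_beltrami ::
    "(real^2 \<Rightarrow> real^3) \<Rightarrow> (real^2 \<Rightarrow> real) \<Rightarrow> real^2 \<Rightarrow> real" where
  "laplace_beltrami x f p =
     (\<Sum>i\<in>UNIV. partial i (\<lambda>q. sqrt (det (iso_metric x q)) *
         (\<Sum>j\<in>UNIV. matrix_inv (iso_metric x q) $ i $ j * partial j f q)) p)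
     / sqrt (det (iso_metric x p))"

definition laplace_eigen ::
    "(real^2 \<Rightarrow> real^3) \<Rightarrow> (real^2) set \<Rightarrow> (real^2 \<Rightarrow> real) \<Rightarrow> real \<Rightarrow> bool" where
  "laplace_eigen x D f \<mu> \<longleftrightarrow> (\<forall>p\<in>D. - laplace_beltrami x f p = \<mu> * f p)"

text \<open>For an admissible surface the third coordinate of the cross product does not vanish.\<close>

definition minimal_normal :: "(real^2 \<Rightarrow> real^3) \<Rightarrow> real^2 \<Rightarrow> real^3" where
  "minimal_normal x p =
     (let X = cross3 (partial 1 x p) (partial 2 x p) in (1 / X$3) *\<^sub>R X)"

definition parabolic_normal :: "(real^2 \<Rightarrow> real^3) \<Rightarrow> real^2 \<Rightarrow> real^3" where
  "parabolic_normal x p =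
     (let N = minimal_normal x p
      in vector [N$1, N$2, 1/2 - 1/2 * ((N$1)\<^sup>2 + (N$2)\<^sup>2)])"

text \<open>Parameters are \<open>u = p$1\<close> and \<open>t = p$2\<close>.\<close>

definition helicoidal :: "real \<Rightarrow> (real \<Rightarrow> real) \<Rightarrow> real^2 \<Rightarrow> real^3" where
  "helicoidal c z p =
     vector [p$1 * cos (p$2), p$1 * sin (p$2), z (p$1) + c * p$2]"

definition helicoidal_domain :: "(real^2) set" where
  "helicoidal_domain = {p. p$1 > 0}"

definition smooth_on_positive :: "(real \<Rightarrow> real) \<Rightarrow> bool" where
  "smooth_on_positive z \<longleftrightarrow> (\<forall>n. (deriv ^^ n) z differentiable_on {0<..})"

text \<open>
  As the planes of simply isotropic space are those of \<open>real^3\<close>, a piece of a plane is a subset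
  that is open in the relative topology of some two-dimensional affine subspace.
\<close>

definition piece_of_plane :: "(real^3) set \<Rightarrow> bool" where
  "piece_of_plane S \<longleftrightarrow>
     (\<exists>P. affine P \<and> aff_dim P = 2 \<and> openin (top_of_set P) S)"

end

theory Submission
  imports Defs
begin

text \<open>
  Write \<open>w = z'\<close>. The metric of the surface is that of the plane in polar coordinates, so the
  hypotheses are linear equations between the polar Laplacian of each \<open>G\<^sup>i\<close> and \<open>G\<^sup>i\<close> itself.
  In \<open>G\<^sup>1 = (c/u) sin t - w cos t\<close> the first term is harmonic; comparing the two Fourier modes in
  \<open>t\<close> gives \<open>\<mu> c = 0\<close> and a Bessel equation for \<open>w\<close>. With \<open>p = u w'\<close> the latter is the first-order
  system \<open>u w' = p\<close>, \<open>u p' = (1 - \<mu> u\<^sup>2) w\<close>. Once this system eliminates \<open>w''\<close>,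
  the equation for \<open>G\<^sup>3\<close> is a polynomial relation between \<open>u\<close>, \<open>w\<close> and \<open>p\<close>, and the
  problem is overdetermined.

  If \<open>\<mu> = 0\<close>, then \<open>w = a u + b/u\<close>, and comparing powers of \<open>u\<close> in the relation
  forces \<open>a = b = c = 0\<close> (\<open>harmonic_case\<close>).

  If \<open>\<mu> \<noteq> 0\<close>, then \<open>c = 0\<close>. Differentiating the relation along the system and
  eliminating its inhomogeneous part leaves a quadratic form in \<open>(w, p)\<close>,
  \<open>(p - w)\<^sup>2 = k u\<^sup>2 w p\<close> with \<open>k = (\<nu> - 4 \<mu>)/2\<close>. If \<open>k = 0\<close>, then \<open>p = w\<close>,
  which the system allows only for \<open>w = 0\<close>. If \<open>k \<noteq> 0\<close>, differentiating once more gives a second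
  quadratic form, divisible by \<open>w\<close>. Where \<open>w \<noteq> 0\<close> it prescribes the ratio of \<open>p\<close> and \<open>w\<close>
  as a function of \<open>u\<^sup>2\<close>; inserted into the first form, this makes a nonzero cubic vanish at
  \<open>u\<^sup>2\<close>. As \<open>w\<close> is continuous, it would have infinitely many roots unless \<open>w\<close> vanishes
  identically (\<open>nonzero_eigenvalue_case\<close>).

  In both cases \<open>c = 0\<close> and \<open>z\<close> is constant, so that the surface is a horizontal plane with the
  point on the axis removed.
\<close>

section \<open>Derivatives in the parameter plane\<close>

text \<open>
  The next two lemmas turn a coordinate derivative on \<open>real^2\<close> into an ordinary derivative. For
  \<open>u\<close> the formula for \<open>f\<close> is needed only where \<open>u > 0\<close>, because a half-plane is
  a neighbourhood of each of its points; this matters as quotients by \<open>u\<close> appear.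
\<close>

lemma partial_1_eqI:
  assumes f: "\<And>q. q$1 > 0 \<Longrightarrow> f q = F (q$1) (q$2)" and p: "p$1 > 0"
    and F: "((\<lambda>u. F u (p$2)) has_vector_derivative d) (at (p$1))"
  shows "partial 1 f p = d"
proof -
  have "((\<lambda>s. p$1 + s) has_vector_derivative 1) (at 0)"
    by (auto intro!: derivative_eq_intros)
  from vector_diff_chain_at[OF this, of "\<lambda>u. F u (p$2)" d] F
  have "((\<lambda>s. F (p$1 + s) (p$2)) has_vector_derivative d) (at 0)"
    by (simp add: o_def)
  then have "((\<lambda>s. f (p + s *\<^sub>R axis 1 1)) has_vector_derivative d) (at 0)"
    by (rule has_vector_derivative_transform_within_open[where S = "{- p$1<..}"])
      (use p in \<open>auto simp: f axis_def\<close>)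
  then show ?thesis
    unfolding partial_def by (rule vector_derivative_at)
qed

lemma partial_2_eqI:
  assumes f: "\<And>q. q$1 > 0 \<Longrightarrow> f q = F (q$1) (q$2)" and p: "p$1 > 0"
    and F: "((\<lambda>t. F (p$1) t) has_vector_derivative d) (at (p$2))"
  shows "partial 2 f p = d"
proof -
  have "((\<lambda>s. p$2 + s) has_vector_derivative 1) (at 0)"
    by (auto intro!: derivative_eq_intros)
  from vector_diff_chain_at[OF this, of "\<lambda>t. F (p$1) t" d] F
  have "((\<lambda>s. F (p$1) (p$2 + s)) has_vector_derivative d) (at 0)"
    by (simp add: o_def)
  moreover have "(\<lambda>s. f (p + s *\<^sub>R axis 2 1)) = (\<lambda>s. F (p$1) (p$2 + s))"
    using p by (auto simp: f axis_def)
  ultimately show ?thesis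
    unfolding partial_def by (simp add: vector_derivative_at)
qed

lemma has_vector_derivative_vector_3:
  fixes f g h :: "real \<Rightarrow> real"
  assumes "(f has_real_derivative a) (at x)" "(g has_real_derivative b) (at x)"
    "(h has_real_derivative d) (at x)"
  shows "((\<lambda>s. vector [f s, g s, h s] :: real^3) has_vector_derivative vector [a, b, d]) (at x)"
proof -
  have *: "(vector [r, s, t] :: real^3) = r *\<^sub>R axis 1 1 + s *\<^sub>R axis 2 1 + t *\<^sub>R axis 3 1"
    for r s t :: real
    by (simp add: vec_eq_iff forall_3 axis_def)
  show ?thesis
    unfolding * using assms by (auto intro!: derivative_eq_intros)
qed

section \<open>The geometry of a helicoidal surface\<close>

lemma smooth_on_positive_DERIV:
  assumes "smooth_on_positive z" "u > 0"
  shows "((deriv ^^ n) z has_real_derivative (deriv ^^ Suc n) z u) (at u)"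
proof -
  have "(deriv ^^ n) z differentiable (at u)"
    using assms by (auto simp: smooth_on_positive_def differentiable_on_eq_differentiable_at)
  then show ?thesis
    by (simp add: DERIV_deriv_iff_real_differentiable)
qed

lemma helicoidal_partials:
  assumes z: "(z has_real_derivative z') (at (p$1))" and p: "p$1 > 0"
  shows "partial 1 (helicoidal c z) p = vector [cos (p$2), sin (p$2), z']"
    and "partial 2 (helicoidal c z) p = vector [- p$1 * sin (p$2), p$1 * cos (p$2), c]"
proof -
  let ?F = "\<lambda>u t. vector [u * cos t, u * sin t, z u + c * t] :: real^3"
  show "partial 1 (helicoidal c z) p = vector [cos (p$2), sin (p$2), z']"
    by (rule partial_1_eqI[where F = ?F])
      (use z p in \<open>auto simp: helicoidal_def intro!: has_vector_derivative_vector_3 derivative_eq_intros\<close>)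
  show "partial 2 (helicoidal c z) p = vector [- p$1 * sin (p$2), p$1 * cos (p$2), c]"
    by (rule partial_2_eqI[where F = ?F])
      (use p in \<open>auto simp: helicoidal_def intro!: has_vector_derivative_vector_3 derivative_eq_intros\<close>)
qed

lemma helicoidal_metric:
  assumes z: "(z has_real_derivative z') (at (p$1))" and p: "p$1 > 0"
  shows "iso_metric (helicoidal c z) p = (\<chi> i j. if i = j then if i = 1 then 1 else (p$1)\<^sup>2 else 0)"
proof -
  have "(p$1 * sin (p$2))\<^sup>2 + (p$1 * cos (p$2))\<^sup>2 = (p$1)\<^sup>2 * ((sin (p$2))\<^sup>2 + (cos (p$2))\<^sup>2)"
    by algebra
  then have "(p$1 * sin (p$2))\<^sup>2 + (p$1 * cos (p$2))\<^sup>2 = (p$1)\<^sup>2"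
    by simp
  then show ?thesis
    using sin_cos_squared_add[of "p$2"]
    by (simp add: iso_metric_def helicoidal_partials[OF z p] iso_inner_def vec_eq_iff forall_2
        power2_eq_square)
qed

lemma matrix_inv_eqI:
  fixes A B :: "real^'n^'n"
  assumes "A ** B = mat 1"
  shows "matrix_inv A = B"
proof -
  have "B ** A = mat 1"
    using assms by (simp add: matrix_left_right_inverse)
  then have "matrix_inv A ** A = mat 1"
    unfolding matrix_inv_def
    by (intro someI2[where a = B and Q = "\<lambda>C. C ** A = mat 1"]) (simp_all add: assms)
  then have "matrix_inv A ** (A ** B) = B"
    by (simp add: matrix_mul_assoc)
  then show ?thesis
    by (simp add: assms)
qed

lemma helicoidal_matrix_inv:
  assumes z: "(z has_real_derivative z') (at (p$1))" and p: "p$1 > 0"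
  shows "matrix_inv (iso_metric (helicoidal c z) p) =
    (\<chi> i j. if i = j then if i = 1 then 1 else 1 / (p$1)\<^sup>2 else 0)"
  by (rule matrix_inv_eqI)
    (use p in \<open>simp add: helicoidal_metric[OF z p] matrix_matrix_mult_def vec_eq_iff forall_2 sum_2 mat_def\<close>)

text \<open>
  The third coordinate of the surface is invisible to the degenerate metric, so its metric is
  \<open>du\<^sup>2 + u\<^sup>2 dt\<^sup>2\<close> for all \<open>c\<close> and \<open>z\<close> and the operator is the polar Laplacian.
\<close>

lemma laplace_beltrami_helicoidal:
  fixes F :: "real \<Rightarrow> real \<Rightarrow> real"
  assumes z: "\<And>u. u > 0 \<Longrightarrow> (z has_real_derivative z' u) (at u)"
    and f: "\<And>q. q$1 > 0 \<Longrightarrow> f q = F (q$1) (q$2)"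
    and Fu: "\<And>u t. u > 0 \<Longrightarrow> ((\<lambda>u. F u t) has_real_derivative Fu u t) (at u)"
    and Ft: "\<And>u t. u > 0 \<Longrightarrow> ((\<lambda>t. F u t) has_real_derivative Ft u t) (at t)"
    and Fuu: "\<And>u t. u > 0 \<Longrightarrow> ((\<lambda>u. Fu u t) has_real_derivative Fuu u t) (at u)"
    and Ftt: "\<And>u t. u > 0 \<Longrightarrow> ((\<lambda>t. Ft u t) has_real_derivative Ftt u t) (at t)"
    and p: "p$1 = u" "p$2 = t" "u > 0"
  shows "laplace_beltrami (helicoidal c z) f p = Fuu u t + Fu u t / u + Ftt u t / u\<^sup>2"
proof -
  have d1: "partial 1 f q = Fu (q$1) (q$2)" if "q$1 > 0" for q
    by (rule partial_1_eqI[where F = F])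
      (use that Fu in \<open>auto simp: f simp flip: has_real_derivative_iff_has_vector_derivative\<close>)
  have d2: "partial 2 f q = Ft (q$1) (q$2)" if "q$1 > 0" for q
    by (rule partial_2_eqI[where F = F])
      (use that Ft in \<open>auto simp: f simp flip: has_real_derivative_iff_has_vector_derivative\<close>)
  have sq: "sqrt (det (iso_metric (helicoidal c z) q)) = q$1" if "q$1 > 0" for q
    using that by (simp add: helicoidal_metric[OF z] det_2)
  let ?flux = "\<lambda>i q. sqrt (det (iso_metric (helicoidal c z) q)) *
     (\<Sum>j\<in>UNIV. matrix_inv (iso_metric (helicoidal c z) q) $ i $ j * partial j f q)"
  have flux1: "?flux 1 q = q$1 * Fu (q$1) (q$2)" if "q$1 > 0" for q
    using that by (simp add: sq helicoidal_matrix_inv[OF z] sum_2 d1)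
  have flux2: "?flux 2 q = Ft (q$1) (q$2) / q$1" if "q$1 > 0" for q
    using that by (simp add: sq helicoidal_matrix_inv[OF z] sum_2 d2 power2_eq_square)
  have D1: "partial 1 (?flux 1) p = Fu u t + u * Fuu u t"
  proof (rule partial_1_eqI[where F = "\<lambda>u t. u * Fu u t", OF flux1])
    have "((\<lambda>u. u * Fu u t) has_real_derivative Fu u t + u * Fuu u t) (at u)"
      using p by (auto intro!: derivative_eq_intros Fuu)
    then show "((\<lambda>u. u * Fu u (p$2)) has_vector_derivative Fu u t + u * Fuu u t) (at (p$1))"
      using p by (simp add: has_real_derivative_iff_has_vector_derivative)
  qed (use p in auto)
  have D2: "partial 2 (?flux 2) p = Ftt u t / u"
  proof (rule partial_2_eqI[where F = "\<lambda>u t. Ft u t / u", OF flux2])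
    have "((\<lambda>t. Ft u t / u) has_real_derivative Ftt u t / u) (at t)"
      using p by (auto intro!: derivative_eq_intros Ftt)
    then show "((\<lambda>t. Ft (p$1) t / p$1) has_vector_derivative Ftt u t / u) (at (p$2))"
      using p by (simp add: has_real_derivative_iff_has_vector_derivative)
  qed (use p in auto)
  show ?thesis
    unfolding laplace_beltrami_def sum_2[of "\<lambda>i. partial i (?flux i) p"] D1 D2
    using p by (simp add: sq field_simps power2_eq_square)
qed

lemma helicoidal_parabolic_normal:
  assumes z: "(z has_real_derivative z') (at (p$1))" and p: "p$1 > 0"
  defines "u \<equiv> p$1" and "t \<equiv> p$2"
  shows "parabolic_normal (helicoidal c z) p =
    vector [c / u * sin t - z' * cos t, - (c / u * cos t) - z' * sin t,
      1/2 * (1 - c\<^sup>2 / u\<^sup>2 - z'\<^sup>2)]"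
proof -
  have "u \<noteq> 0" using p by (simp add: u_def)
  have area: "cos t * (u * cos t) + u * sin t * sin t = u"
    using sin_cos_squared_add[of t] by algebra
  have N: "minimal_normal (helicoidal c z) p =
      vector [c / u * sin t - z' * cos t, - (c / u * cos t) - z' * sin t, 1]"
    using \<open>u \<noteq> 0\<close> area
    by (simp add: minimal_normal_def Let_def helicoidal_partials[OF z p] cross3_def
        vec_eq_iff forall_3 field_simps flip: u_def t_def)
  have "(c / u * sin t - z' * cos t)\<^sup>2 + (- (c / u * cos t) - z' * sin t)\<^sup>2
      = ((c / u)\<^sup>2 + z'\<^sup>2) * ((sin t)\<^sup>2 + (cos t)\<^sup>2)"
    by algebra
  also have "\<dots> = c\<^sup>2 / u\<^sup>2 + z'\<^sup>2"
    by (simp add: power_divide)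
  finally have norm: "(c / u * sin t - z' * cos t)\<^sup>2 + (- (c / u * cos t) - z' * sin t)\<^sup>2
      = c\<^sup>2 / u\<^sup>2 + z'\<^sup>2" .
  have "1/2 - 1/2 * (c\<^sup>2 / u\<^sup>2 + z'\<^sup>2) = 1/2 * (1 - c\<^sup>2 / u\<^sup>2 - z'\<^sup>2)"
    by (simp add: algebra_simps)
  then show ?thesis
    by (simp only: parabolic_normal_def Let_def N vector_3 norm)
qed

section \<open>Reduction to ordinary differential equations\<close>

text \<open>
  Evaluating the equation for the first coordinate at \<open>t = \<pi>/2\<close> isolates its \<open>sin t\<close> mode, whose
  Laplacian is zero, and \<open>t = 0\<close> isolates the \<open>cos t\<close> mode. The third coordinate is radial, so
  any \<open>t\<close> carries its whole content.
\<close>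

lemma helicoidal_eigen_equations:
  assumes z: "\<And>u. u > 0 \<Longrightarrow> (z has_real_derivative w u) (at u)"
    and w: "\<And>u. u > 0 \<Longrightarrow> (w has_real_derivative w1 u) (at u)"
    and w1: "\<And>u. u > 0 \<Longrightarrow> (w1 has_real_derivative w2 u) (at u)"
    and u: "u > 0"
  shows "laplace_eigen (helicoidal c z) helicoidal_domain
           (\<lambda>p. parabolic_normal (helicoidal c z) p $ 1) \<mu> \<Longrightarrow> \<mu> * c = 0"
    and "laplace_eigen (helicoidal c z) helicoidal_domain
           (\<lambda>p. parabolic_normal (helicoidal c z) p $ 1) \<mu> \<Longrightarrow>
           w2 u + w1 u / u - w u / u\<^sup>2 = - \<mu> * w u"
    and "laplace_eigen (helicoidal c z) helicoidal_domain
           (\<lambda>p. parabolic_normal (helicoidal c z) p $ 3) \<nu> \<Longrightarrow>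
           4 * c\<^sup>2 / u ^ 4 + 2 * (w1 u)\<^sup>2 + 2 * w u * (w2 u + w1 u / u)
             = \<nu> * (1 - c\<^sup>2 / u\<^sup>2 - (w u)\<^sup>2)"
proof -
  note normal = helicoidal_parabolic_normal[OF z]
  have L1: "laplace_beltrami (helicoidal c z) (\<lambda>p. parabolic_normal (helicoidal c z) p $ 1)
      (vector [u, t]) = - (w2 u + w1 u / u - w u / u\<^sup>2) * cos t" for t
  proof -
    have "laplace_beltrami (helicoidal c z) (\<lambda>p. parabolic_normal (helicoidal c z) p $ 1)
      (vector [u, t]) = (2 * c / u^3 * sin t - w2 u * cos t)
        + (- (c / u\<^sup>2) * sin t - w1 u * cos t) / u + (- (c / u * sin t) + w u * cos t) / u\<^sup>2"
      by (rule laplace_beltrami_helicoidal[where F = "\<lambda>u t. c / u * sin t - w u * cos t"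
            and Fu = "\<lambda>u t. - (c / u\<^sup>2) * sin t - w1 u * cos t"
            and Ft = "\<lambda>u t. c / u * cos t + w u * sin t"
            and Fuu = "\<lambda>u t. 2 * c / u^3 * sin t - w2 u * cos t"
            and Ftt = "\<lambda>u t. - (c / u * sin t) + w u * cos t", OF z])
        (use u in \<open>auto simp: normal power2_eq_square power3_eq_cube field_simps
            intro!: derivative_eq_intros w w1\<close>)
    also have "\<dots> = - (w2 u + w1 u / u - w u / u\<^sup>2) * cos t"
      using u by (simp add: field_simps power2_eq_square power3_eq_cube)
    finally show ?thesis .
  qed
  have G1: "parabolic_normal (helicoidal c z) (vector [u, t]) $ 1
      = c / u * sin t - w u * cos t" for t
    using u by (simp add: normal)
  have in_dom: "vector [u, t] \<in> helicoidal_domain" for t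
    using u by (simp add: helicoidal_domain_def)
  show "\<mu> * c = 0" if E: "laplace_eigen (helicoidal c z) helicoidal_domain
           (\<lambda>p. parabolic_normal (helicoidal c z) p $ 1) \<mu>"
    using bspec[OF E[unfolded laplace_eigen_def] in_dom, of "pi/2"] u
    by (simp add: L1 G1)
  show "w2 u + w1 u / u - w u / u\<^sup>2 = - \<mu> * w u"
    if E: "laplace_eigen (helicoidal c z) helicoidal_domain
           (\<lambda>p. parabolic_normal (helicoidal c z) p $ 1) \<mu>"
    using bspec[OF E[unfolded laplace_eigen_def] in_dom, of 0]
    by (simp add: L1 G1)
  show "4 * c\<^sup>2 / u ^ 4 + 2 * (w1 u)\<^sup>2 + 2 * w u * (w2 u + w1 u / u)
             = \<nu> * (1 - c\<^sup>2 / u\<^sup>2 - (w u)\<^sup>2)"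
    if E: "laplace_eigen (helicoidal c z) helicoidal_domain
           (\<lambda>p. parabolic_normal (helicoidal c z) p $ 3) \<nu>"
  proof -
    have "laplace_beltrami (helicoidal c z) (\<lambda>p. parabolic_normal (helicoidal c z) p $ 3)
      (vector [u, 0]) = (- (3 * c\<^sup>2 / u^4) - (w1 u)\<^sup>2 - w u * w2 u)
        + (c\<^sup>2 / u^3 - w u * w1 u) / u + 0 / u\<^sup>2"
      by (rule laplace_beltrami_helicoidal[where F = "\<lambda>u t. 1/2 * (1 - c\<^sup>2 / u\<^sup>2 - (w u)\<^sup>2)"
            and Fu = "\<lambda>u t. c\<^sup>2 / u^3 - w u * w1 u"
            and Ft = "\<lambda>u t. 0"
            and Fuu = "\<lambda>u t. - (3 * c\<^sup>2 / u^4) - (w1 u)\<^sup>2 - w u * w2 u"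
            and Ftt = "\<lambda>u t. 0", OF z])
        (use u in \<open>auto simp: normal power2_eq_square power3_eq_cube power4_eq_xxxx field_simps
            intro!: derivative_eq_intros w w1\<close>)
    also have "\<dots> = - (2 * c\<^sup>2 / u^4) - (w1 u)\<^sup>2 - w u * (w2 u + w1 u / u)"
      using u by (simp add: field_simps power3_eq_cube power4_eq_xxxx)
    finally have "laplace_beltrami (helicoidal c z) (\<lambda>p. parabolic_normal (helicoidal c z) p $ 3)
      (vector [u, 0]) = - (2 * c\<^sup>2 / u^4) - (w1 u)\<^sup>2 - w u * (w2 u + w1 u / u)" .
    moreover have "parabolic_normal (helicoidal c z) (vector [u, 0]) $ 3
        = 1/2 * (1 - c\<^sup>2 / u\<^sup>2 - (w u)\<^sup>2)"
      using u by (simp add: normal)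
    ultimately show ?thesis
      using bspec[OF E[unfolded laplace_eigen_def] in_dom, of 0]
      by (simp only:)
  qed
qed

section \<open>The overdetermined system\<close>

lemma cubic_zero_on_infinite:
  fixes a0 a1 a2 a3 :: real
  assumes "infinite S" and "\<And>s. s \<in> S \<Longrightarrow> a0 + a1 * s + a2 * s^2 + a3 * s^3 = 0"
  shows "a0 = 0 \<and> a1 = 0 \<and> a2 = 0 \<and> a3 = 0"
proof -
  let ?q = "[:a0, a1, a2, a3:]"
  have "S \<subseteq> {s. poly ?q s = 0}"
    using assms(2) by (auto simp: algebra_simps power2_eq_square power3_eq_cube)
  then have "infinite {s. poly ?q s = 0}"
    using assms(1) finite_subset by blast
  then have "?q = 0"
    using poly_roots_finite by blast
  then show ?thesis
    by simp
qed

lemma derivative_zero_if_zero_on_positive: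
  fixes f :: "real \<Rightarrow> real"
  assumes "\<And>v. v > 0 \<Longrightarrow> f v = 0" "u > 0" "(f has_real_derivative d) (at u)"
  shows "d = 0"
proof -
  have "((\<lambda>_. 0) has_real_derivative d) (at u)"
    by (rule has_field_derivative_transform_within_open[OF assms(3), of "{0<..}"]) (use assms in auto)
  then show ?thesis
    using DERIV_unique DERIV_const by blast
qed

lemma zero_derivative_constant_on_positive:
  fixes f :: "real \<Rightarrow> real"
  assumes "\<And>u. u > 0 \<Longrightarrow> (f has_real_derivative 0) (at u)"
  shows "\<exists>a. \<forall>u>0. f u = a"
proof -
  have "\<exists>a. \<forall>u\<in>{0<..}. f u = a"
    by (rule has_field_derivative_zero_constant)
      (use assms in \<open>auto intro: has_field_derivative_at_within\<close>)
  then show ?thesis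
    by auto
qed

text \<open>
  Here \<open>w\<close> solves an Euler equation. Its two first integrals \<open>(w + p)/(2u)\<close> and
  \<open>(w - p) u/2\<close> give \<open>w = a u + b/u\<close>, and multiplying \<open>E\<close> by \<open>2 u\<^sup>2\<close> turns it into
  a cubic identity in \<open>s = u\<^sup>2\<close>, to be read off coefficientwise.
\<close>

lemma harmonic_case:
  fixes w p :: "real \<Rightarrow> real" and c \<nu> :: real
  assumes w: "\<And>u. u > 0 \<Longrightarrow> (w has_real_derivative p u / u) (at u)"
    and p: "\<And>u. u > 0 \<Longrightarrow> (p has_real_derivative w u / u) (at u)"
    and E: "\<And>u. u > 0 \<Longrightarrow> (p u)\<^sup>2 + (w u)\<^sup>2 + 2 * c\<^sup>2 / u\<^sup>2 = \<nu> / 2 * (u\<^sup>2 - c\<^sup>2 - u\<^sup>2 * (w u)\<^sup>2)"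
  shows "c = 0 \<and> (\<forall>u>0. w u = 0)"
proof -
  have "((\<lambda>u. (w u + p u) / (2 * u)) has_real_derivative 0) (at u)" if "u > 0" for u
    using that by (auto intro!: derivative_eq_intros w p simp: field_simps)
  then have "\<exists>a. \<forall>u>0. (w u + p u) / (2 * u) = a"
    by (rule zero_derivative_constant_on_positive)
  then obtain a where a: "\<And>u. u > 0 \<Longrightarrow> (w u + p u) / (2 * u) = a"
    by blast
  have "((\<lambda>u. (w u - p u) * u / 2) has_real_derivative 0) (at u)" if "u > 0" for u
    using that by (auto intro!: derivative_eq_intros w p simp: field_simps)
  then have "\<exists>b. \<forall>u>0. (w u - p u) * u / 2 = b"
    by (rule zero_derivative_constant_on_positive)
  then obtain b where b: "\<And>u. u > 0 \<Longrightarrow> (w u - p u) * u / 2 = b"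
    by blast
  have sum: "w u + p u = 2 * a * u" and diff: "w u - p u = 2 * b / u" if "u > 0" for u
    using a[OF that] b[OF that] that by (auto simp: field_simps)
  have wab: "w u = a * u + b / u" and pab: "p u = a * u - b / u" if "u > 0" for u
    using sum[OF that] diff[OF that] by (simp_all add: field_simps)
  have poly: "4 * (b\<^sup>2 + c\<^sup>2) + \<nu> * (b\<^sup>2 + c\<^sup>2) * s + (4 * a\<^sup>2 - \<nu> + 2 * \<nu> * a * b) * s^2
      + \<nu> * a\<^sup>2 * s^3 = 0" if "s \<in> {0<..}" for s
  proof -
    define u where "u = sqrt s"
    have u: "u > 0" "s = u\<^sup>2"
      using that by (auto simp: u_def)
    define r where "r = 1 / u"
    have r: "r * u = 1" using u by (simp add: r_def)
    have "(a * u - b * r)\<^sup>2 + (a * u + b * r)\<^sup>2 + 2 * c\<^sup>2 * r\<^sup>2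
        = \<nu> / 2 * (u\<^sup>2 - c\<^sup>2 - u\<^sup>2 * (a * u + b * r)\<^sup>2)"
      using E[OF u(1)] u by (simp add: wab pab r_def power_divide)
    then show ?thesis
      using r unfolding u(2) by algebra
  qed
  have coeffs: "4 * (b\<^sup>2 + c\<^sup>2) = 0" "4 * a\<^sup>2 - \<nu> + 2 * \<nu> * a * b = 0" "\<nu> * a\<^sup>2 = 0"
    using cubic_zero_on_infinite[OF infinite_Ioi poly] by auto
  then have "b\<^sup>2 + c\<^sup>2 = 0"
    by (metis mult_eq_0_iff zero_neq_numeral)
  then have "b = 0" "c = 0"
    by (simp_all add: sum_power2_eq_zero_iff)
  moreover from \<open>b = 0\<close> have "a = 0"
    using coeffs(2,3) by auto
  ultimately show ?thesis
    by (simp add: wab)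
qed

text \<open>
  The relation \<open>E\<close> is a first-order constraint on the solutions of a linear system of order two, so
  every derivative of it is another constraint. Two derivatives suffice to exclude nonzero
  solutions: \<open>Q\<close> is homogeneous quadratic in \<open>(w, p)\<close>, and \<open>L\<close> is \<open>w\<close> times a linear form.
\<close>

lemma nonzero_eigenvalue_case:
  fixes w p :: "real \<Rightarrow> real" and \<mu> \<nu> :: real
  assumes w: "\<And>u. u > 0 \<Longrightarrow> (w has_real_derivative p u / u) (at u)"
    and p: "\<And>u. u > 0 \<Longrightarrow> (p has_real_derivative (1 - \<mu> * u\<^sup>2) * w u / u) (at u)"
    and E: "\<And>u. u > 0 \<Longrightarrow> (p u)\<^sup>2 + (w u)\<^sup>2 - \<mu> * u\<^sup>2 * (w u)\<^sup>2 = \<nu> / 2 * (u\<^sup>2 - u\<^sup>2 * (w u)\<^sup>2)"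
    and \<mu>: "\<mu> \<noteq> 0" and u: "u > 0"
  shows "w u = 0"
proof -
  define k where "k = (\<nu> - 4 * \<mu>) / 2"
  have Q: "(p u - w u)\<^sup>2 = k * u\<^sup>2 * w u * p u" if u: "u > 0" for u
  proof -
    let ?f = "\<lambda>u. (p u)\<^sup>2 + (w u)\<^sup>2 - \<mu> * u\<^sup>2 * (w u)\<^sup>2 - \<nu> / 2 * (u\<^sup>2 - u\<^sup>2 * (w u)\<^sup>2)"
    let ?d = "2 * p u * ((1 - \<mu> * u\<^sup>2) * w u / u) + 2 * w u * (p u / u)
      - \<mu> * (2 * u * (w u)\<^sup>2 + u\<^sup>2 * (2 * w u * (p u / u)))
      - \<nu> / 2 * (2 * u - (2 * u * (w u)\<^sup>2 + u\<^sup>2 * (2 * w u * (p u / u))))"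
    have "(?f has_real_derivative ?d) (at u)"
      using u by (auto intro!: derivative_eq_intros w p simp: algebra_simps)
    then have d0: "?d = 0"
      by (rule derivative_zero_if_zero_on_positive[rotated 2]) (use E u in auto)
    have "2 * p u * (1 - \<mu> * u\<^sup>2) * w u + 2 * w u * p u
      - \<mu> * (2 * u\<^sup>2 * (w u)\<^sup>2 + u\<^sup>2 * 2 * w u * p u)
      - \<nu> / 2 * (2 * u\<^sup>2 - (2 * u\<^sup>2 * (w u)\<^sup>2 + u\<^sup>2 * 2 * w u * p u)) = u * ?d"
      using u by (simp add: field_simps power2_eq_square)
    also have "\<dots> = 0"
      by (simp only: d0 mult_zero_right)
    finally have "2 * p u * (1 - \<mu> * u\<^sup>2) * w u + 2 * w u * p u
      - \<mu> * (2 * u\<^sup>2 * (w u)\<^sup>2 + u\<^sup>2 * 2 * w u * p u)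
      - \<nu> / 2 * (2 * u\<^sup>2 - (2 * u\<^sup>2 * (w u)\<^sup>2 + u\<^sup>2 * 2 * w u * p u)) = 0" .
    \<comment> \<open>\<open>E\<close> replaces \<open>\<nu> u\<^sup>2 (1 - w\<^sup>2)\<close>, which makes everything homogeneous quadratic in \<open>(w, p)\<close>.\<close>
    then show ?thesis
      using E[OF u] unfolding k_def by algebra
  qed
  have L: "w u * (\<mu> * (2 + k * u\<^sup>2) * w u - (6 * k + 2 * \<mu> + k\<^sup>2 * u\<^sup>2) * p u) = 0"
    if u: "u > 0" for u
  proof -
    let ?f = "\<lambda>u. (p u - w u)\<^sup>2 - k * u\<^sup>2 * w u * p u"
    let ?d = "2 * (p u - w u) * ((1 - \<mu> * u\<^sup>2) * w u / u - p u / u)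
      - k * (2 * u * w u * p u + u\<^sup>2 * (p u / u * p u + w u * ((1 - \<mu> * u\<^sup>2) * w u / u)))"
    have "(?f has_real_derivative ?d) (at u)"
      using u by (auto intro!: derivative_eq_intros w p simp: algebra_simps)
    then have d0: "?d = 0"
      by (rule derivative_zero_if_zero_on_positive[rotated 2]) (use Q u in auto)
    have "2 * (p u - w u) * ((1 - \<mu> * u\<^sup>2) * w u - p u)
      - k * (2 * u\<^sup>2 * w u * p u + u\<^sup>2 * ((p u)\<^sup>2 + w u * ((1 - \<mu> * u\<^sup>2) * w u))) = u * ?d"
      using u by (simp add: field_simps power2_eq_square)
    also have "\<dots> = 0"
      by (simp only: d0 mult_zero_right)
    finally have "2 * (p u - w u) * ((1 - \<mu> * u\<^sup>2) * w u - p u)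
      - k * (2 * u\<^sup>2 * w u * p u + u\<^sup>2 * ((p u)\<^sup>2 + w u * ((1 - \<mu> * u\<^sup>2) * w u))) = 0" .
    \<comment> \<open>\<open>Q\<close> turns \<open>(p - w)\<^sup>2\<close> into a multiple of \<open>u\<^sup>2 w\<close>, and enters again through
      \<open>p\<^sup>2 + w\<^sup>2 = (p - w)\<^sup>2 + 2 w p\<close>; then \<open>u\<^sup>2 w\<close> factors out.\<close>
    then have "u\<^sup>2 * (w u * (\<mu> * (2 + k * u\<^sup>2) * w u - (6 * k + 2 * \<mu> + k\<^sup>2 * u\<^sup>2) * p u)) = 0"
      using Q[OF u] by algebra
    then show ?thesis
      using u by simp
  qed
  show ?thesis
  proof (cases "k = 0")
    case True
    then have pw: "p v = w v" if "v > 0" for v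
      using Q[OF that] by simp
    have "((\<lambda>v. p v - w v) has_real_derivative (1 - \<mu> * u\<^sup>2) * w u / u - p u / u) (at u)"
      using u by (auto intro!: derivative_eq_intros w p)
    then have "(1 - \<mu> * u\<^sup>2) * w u / u - p u / u = 0"
      by (rule derivative_zero_if_zero_on_positive[rotated 2]) (use pw u in auto)
    then show ?thesis
      using u \<mu> by (simp add: pw field_simps)
  next
    case False
    show ?thesis
    proof (rule ccontr)
      assume "w u \<noteq> 0"
      define S where "S = {0<..} \<inter> w -` (- {0})"
      have "continuous_on {0<..} w"
        using w by (intro DERIV_continuous_on[of _ w "\<lambda>u. p u / u"]) (auto intro: DERIV_subset)
      then have "open S"
        unfolding S_def by (rule continuous_open_preimage) auto
      then have "infinite S"
        using finite_imp_not_open \<open>w u \<noteq> 0\<close> u by (auto simp: S_def)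
      moreover have "inj_on (\<lambda>v. v\<^sup>2) S"
        by (rule inj_onI) (auto simp: S_def power2_eq_iff_nonneg less_imp_le)
      ultimately have inf: "infinite ((\<lambda>v. v\<^sup>2) ` S)"
        using finite_imageD by blast
      \<comment> \<open>With \<open>A w = B p\<close> from \<open>L\<close>, the form \<open>Q\<close> becomes \<open>(A - B)\<^sup>2 = k s A B\<close>
        for \<open>s = u\<^sup>2\<close>. At \<open>s = 0\<close> the right-hand side vanishes but \<open>A - B = - 6 k\<close>,
        so this cubic equation in \<open>s\<close> is not an identity.\<close>
      let ?A = "\<lambda>s. \<mu> * (2 + k * s)" and ?B = "\<lambda>s. 6 * k + 2 * \<mu> + k\<^sup>2 * s"
      have root: "- (36 * k\<^sup>2) + (k * (2 * \<mu>) * (6 * k + 2 * \<mu>) + 12 * k * (k * \<mu> - k\<^sup>2)) * s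
          + (k * (2 * \<mu> * k\<^sup>2 + k * \<mu> * (6 * k + 2 * \<mu>)) - (k * \<mu> - k\<^sup>2)\<^sup>2) * s^2
          + \<mu> * k^4 * s^3 = 0" if "s \<in> (\<lambda>v. v\<^sup>2) ` S" for s
      proof -
        from that obtain v where v: "s = v\<^sup>2" "v > 0" "w v \<noteq> 0"
          by (auto simp: S_def)
        have lin: "?A s * w v = ?B s * p v"
          using L[OF v(2)] v by simp
        have "(w v)\<^sup>2 * (?A s - ?B s)\<^sup>2 = (w v)\<^sup>2 * (k * s * ?A s * ?B s)"
          using Q[OF v(2)] lin unfolding v(1)[symmetric] by algebra
        then have "(?A s - ?B s)\<^sup>2 = k * s * ?A s * ?B s"
          using v(3) by simp
        then show ?thesis
          by algebra
      qed
      have "- (36 * k\<^sup>2) = 0"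
        using cubic_zero_on_infinite[OF inf root] by blast
      then show False
        using False by simp
    qed
  qed
qed

section \<open>The plane\<close>

lemma flat_helicoidal_piece_of_plane:
  assumes z: "\<And>u. u > 0 \<Longrightarrow> z u = h"
  shows "piece_of_plane (helicoidal 0 z ` helicoidal_domain)"
proof -
  let ?P = "{x :: real^3. axis 3 1 \<bullet> x = h}"
  let ?U = "{x :: real^3. (x$1)\<^sup>2 + (x$2)\<^sup>2 > 0}"
  have "helicoidal 0 z ` helicoidal_domain = ?P \<inter> ?U"
  proof (intro equalityI subsetI)
    fix x assume "x \<in> helicoidal 0 z ` helicoidal_domain"
    then obtain p where p: "p$1 > 0" and x: "x = helicoidal 0 z p"
      by (auto simp: helicoidal_domain_def)
    have "(x$1)\<^sup>2 + (x$2)\<^sup>2 = (p$1)\<^sup>2 * ((sin (p$2))\<^sup>2 + (cos (p$2))\<^sup>2)"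
      unfolding x helicoidal_def vector_3 by algebra
    then show "x \<in> ?P \<inter> ?U"
      using p x z by (simp add: helicoidal_def inner_axis')
  next
    fix x assume x: "x \<in> ?P \<inter> ?U"
    define u where "u = sqrt ((x$1)\<^sup>2 + (x$2)\<^sup>2)"
    have u: "u > 0" "u\<^sup>2 = (x$1)\<^sup>2 + (x$2)\<^sup>2"
      using x by (auto simp: u_def)
    then have "(x$1 / u)\<^sup>2 + (x$2 / u)\<^sup>2 = 1"
      using u(1) by (simp add: power_divide flip: add_divide_distrib u(2))
    then obtain t where t: "x$1 / u = cos t" "x$2 / u = sin t"
      by (rule sincos_total_2pi)
    have "x = helicoidal 0 z (vector [u, t])"
      using x u z t[symmetric] by (simp add: helicoidal_def vec_eq_iff forall_3 inner_axis')
    then show "x \<in> helicoidal 0 z ` helicoidal_domain"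
      using u by (auto simp: helicoidal_domain_def)
  qed
  moreover have "open ?U"
    by (intro open_Collect_less continuous_intros)
  ultimately have "openin (top_of_set ?P) (helicoidal 0 z ` helicoidal_domain)"
    by (simp add: openin_open_Int)
  moreover have "aff_dim ?P = 2"
    by (subst aff_dim_hyperplane) (auto simp: axis_eq_0_iff)
  ultimately show ?thesis
    unfolding piece_of_plane_def using affine_hyperplane by blast
qed

theorem theorem4p2:
  fixes c \<mu> \<nu> :: real and z :: "real \<Rightarrow> real"
  assumes "smooth_on_positive z"
    and "laplace_eigen (helicoidal c z) helicoidal_domain
           (\<lambda>p. parabolic_normal (helicoidal c z) p $ 1) \<mu>"
    and "laplace_eigen (helicoidal c z) helicoidal_domain
           (\<lambda>p. parabolic_normal (helicoidal c z) p $ 2) \<mu>"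
    and "laplace_eigen (helicoidal c z) helicoidal_domain
           (\<lambda>p. parabolic_normal (helicoidal c z) p $ 3) \<nu>"
  shows "piece_of_plane (helicoidal c z ` helicoidal_domain)"
proof -
  define w w1 w2 where "w = deriv z" and "w1 = deriv w" and "w2 = deriv w1"
  have z: "(z has_real_derivative w u) (at u)" and w: "(w has_real_derivative w1 u) (at u)"
    and w1: "(w1 has_real_derivative w2 u) (at u)" if "u > 0" for u
    using smooth_on_positive_DERIV[OF assms(1) that, of 0]
      smooth_on_positive_DERIV[OF assms(1) that, of 1]
      smooth_on_positive_DERIV[OF assms(1) that, of 2]
    by (simp_all add: w_def w1_def w2_def numeral_2_eq_2)
  note eqs = helicoidal_eigen_equations[OF z w w1]
  have \<mu>c: "\<mu> * c = 0"
    using eqs(1)[OF _ _ _ _ assms(2), of 1] by simp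
  have ode: "w2 u = (1 / u\<^sup>2 - \<mu>) * w u - w1 u / u" if "u > 0" for u
    using eqs(2)[OF _ _ _ that assms(2)] by (simp add: algebra_simps)
  define p where "p u = u * w1 u" for u
  have Dw: "(w has_real_derivative p u / u) (at u)" if "u > 0" for u
    using w[OF that] that by (simp add: p_def)
  have Dp: "(p has_real_derivative (1 - \<mu> * u\<^sup>2) * w u / u) (at u)" if u: "u > 0" for u
  proof -
    have "(p has_real_derivative w1 u + u * w2 u) (at u)"
      unfolding p_def using u by (auto intro!: derivative_eq_intros w1)
    also have "w1 u + u * w2 u = (1 - \<mu> * u\<^sup>2) * w u / u"
      using u by (simp add: ode field_simps power2_eq_square)
    finally show ?thesis .
  qed
  have E: "(p u)\<^sup>2 + (w u)\<^sup>2 - \<mu> * u\<^sup>2 * (w u)\<^sup>2 + 2 * c\<^sup>2 / u\<^sup>2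
      = \<nu> / 2 * (u\<^sup>2 - c\<^sup>2 - u\<^sup>2 * (w u)\<^sup>2)" if u: "u > 0" for u
  proof -
    define r where "r = 1 / u"
    have r: "r * u = 1" using u by (simp add: r_def)
    have "4 * c\<^sup>2 * r^4 + 2 * (w1 u)\<^sup>2 + 2 * w u * ((r\<^sup>2 - \<mu>) * w u)
        = \<nu> * (1 - c\<^sup>2 * r\<^sup>2 - (w u)\<^sup>2)"
      using eqs(3)[OF _ _ _ u assms(4)] by (simp add: ode[OF u] r_def power_divide)
    then have "(u * w1 u)\<^sup>2 + (w u)\<^sup>2 - \<mu> * u\<^sup>2 * (w u)\<^sup>2 + 2 * c\<^sup>2 * r\<^sup>2
      = \<nu> / 2 * (u\<^sup>2 - c\<^sup>2 - u\<^sup>2 * (w u)\<^sup>2)"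
      using r by algebra
    then show ?thesis
      by (simp add: p_def r_def power_divide)
  qed
  have flat: "c = 0 \<and> (\<forall>u>0. w u = 0)"
  proof (cases "\<mu> = 0")
    case True
    show ?thesis
      by (rule harmonic_case[of w p]) (use Dw Dp E True in auto)
  next
    case False
    then have "c = 0" using \<mu>c by simp
    have "w u = 0" if "u > 0" for u
      by (rule nonzero_eigenvalue_case[where \<nu> = \<nu>, OF Dw Dp _ False that])
        (use E \<open>c = 0\<close> in simp_all)
    with \<open>c = 0\<close> show ?thesis by blast
  qed
  then have "(z has_real_derivative 0) (at u)" if "u > 0" for u
    using z[of u] that by simp
  then have "\<exists>h. \<forall>u>0. z u = h"
    by (rule zero_derivative_constant_on_positive)
  then obtain h where "\<And>u. u > 0 \<Longrightarrow> z u = h"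
    by blast
  then show ?thesis
    using flat flat_helicoidal_piece_of_plane by blast
qed

end
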